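(* Let $M,n\ge1$ and $N=Mn$. For $m=1,\dots,M$ and $j=1,\dots,n$ let $f_{mj}:\mathbb{R}^d\to\mathbb{R}$ be $L_{\max}$-smooth and $\mu$-strongly convex with $\mu>0$, and let $F_m=\sum_{j=1}^n f_{mj}$. Let $x_\ast$ be the minimizer of $\frac1N\sum_{m=1}^M F_m(x)$ over $\mathbb{R}^d$, and assume that $\nabla F_m(x_\ast)=0$ for every $m$. If $0<\gamma\le\frac1{L_{\max}}$, then for every $T\ge 0$ the iterates of FedRR (or FedSO) with stepsize $\gamma$ and no regularizer ($R\equiv0$), started at $x_0\in\mathbb{R}^d$, satisfy $$\mathbb{E}\|x_T-x_\ast\|^2\le(1-\gamma\mu)^{nT}\|x_0-x_\ast\|^2+\frac{\gamma^2L_{\max}N\sigma_\ast^2}{M\mu},$$ where $\sigma_\ast^2=\frac1N\sum_{i=1}^n\sum_{m=1}^M\|\nabla f_{mi}(x_\ast)\|^2$.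
   Context: A differentiable function $\phi:\mathbb{R}^d\to\mathbb{R}$ has Bregman divergence $D_\phi(x,y)=\phi(x)-\phi(y)-\langle\nabla\phi(y),x-y\rangle$. It is $L$-smooth if it is continuously differentiable and $D_\phi(x,y)\le\frac L2\|x-y\|^2$ for all $x,y$, and $\mu$-strongly convex if $\frac\mu2\|x-y\|^2\le D_\phi(x,y)$ for all $x,y$. Algorithm (FedRR / FedSO) with $R\equiv0$, in the case where each of the $M$ devices has $n$ functions: for each epoch $t=0,1,\dots,T-1$ and each device $m=1,\dots,M$, set $x_{t,m}^0=x_t$, take a permutation $(\pi_{0,m},\dots,\pi_{n-1,m})$ of $\{1,\dots,n\}$, and for $i=0,\dots,n-1$ set $x_{t,m}^{i+1}=x_{t,m}^i-\gamma\nabla f_{m\pi_{i,m}}(x_{t,m}^i)$. Then set $x_{t+1}=\frac1M\sum_{m=1}^M x_{t,m}^n$ (the proximal step is the identity since $R\equiv0$). In FedRR the permutations are uniformly random and sampled afresh (independently across devices and epochs) in every epoch; in FedSO a uniformly random permutation is sampled once for each device (independently across devices) and used in all epochs. *)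

theory Defs
  imports "HOL-Probability.Probability"
begin

text \<open>The value of \<open>grad\<close> is meaningful only at points of differentiability, where it is the
  unique vector representing the derivative (lemma \<open>GDERIV_grad\<close> below).\<close>

definition grad :: "('a::real_inner \<Rightarrow> real) \<Rightarrow> 'a \<Rightarrow> 'a" where
  "grad f x = (THE D. GDERIV f x :> D)"

definition bregman :: "('a::real_inner \<Rightarrow> real) \<Rightarrow> 'a \<Rightarrow> 'a \<Rightarrow> real" where
  "bregman \<phi> x y = \<phi> x - \<phi> y - grad \<phi> y \<bullet> (x - y)"

definition smooth_fun :: "real \<Rightarrow> ('a::real_inner \<Rightarrow> real) \<Rightarrow> bool" where
  "smooth_fun L \<phi> \<longleftrightarrow>
     (\<forall>x. \<phi> differentiable (at x)) \<and> continuous_on UNIV (grad \<phi>) \<and>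
     (\<forall>x y. bregman \<phi> x y \<le> L / 2 * (norm (x - y))\<^sup>2)"

definition strongly_convex_fun :: "real \<Rightarrow> ('a::real_inner \<Rightarrow> real) \<Rightarrow> bool" where
  "strongly_convex_fun \<mu> \<phi> \<longleftrightarrow>
     (\<forall>x. \<phi> differentiable (at x)) \<and>
     (\<forall>x y. \<mu> / 2 * (norm (x - y))\<^sup>2 \<le> bregman \<phi> x y)"

text \<open>A permutation \<open>(\<pi>\<^sub>0, \<dots>, \<pi>\<^sub>n\<^sub>-\<^sub>1)\<close> of \<open>{1..n}\<close> is an element of
  \<open>permutations_of_set {1..n}\<close>, that is, a list \<open>p\<close> with \<open>\<pi>\<^sub>i = p ! i\<close>.\<close>

primrec local_iter ::
  "real \<Rightarrow> (nat \<Rightarrow> 'a::real_inner \<Rightarrow> real) \<Rightarrow> nat list \<Rightarrow> 'a \<Rightarrow> nat \<Rightarrow> 'a" where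
  "local_iter \<gamma> g p x 0 = x"
| "local_iter \<gamma> g p x (Suc i) =
     local_iter \<gamma> g p x i - \<gamma> *\<^sub>R grad (g (p ! i)) (local_iter \<gamma> g p x i)"

text \<open>The server iterates without regularizer, where device \<open>m\<close> uses the permutation
  \<open>\<pi> (t, m)\<close> in epoch \<open>t\<close>.\<close>

primrec fed_iter ::
  "nat \<Rightarrow> nat \<Rightarrow> real \<Rightarrow> (nat \<Rightarrow> nat \<Rightarrow> 'a::real_inner \<Rightarrow> real) \<Rightarrow> 'a \<Rightarrow> (nat \<times> nat \<Rightarrow> nat list) \<Rightarrow>
   nat \<Rightarrow> 'a" where
  "fed_iter M n \<gamma> f x0 \<pi> 0 = x0"
| "fed_iter M n \<gamma> f x0 \<pi> (Suc t) =
     (1 / real M) *\<^sub>R (\<Sum>m=1..M. local_iter \<gamma> (f m) (\<pi> (t, m)) (fed_iter M n \<gamma> f x0 \<pi> t) n)"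

text \<open>The law of the permutations in the first \<open>T\<close> epochs, which are all that the \<open>T\<close>-th iterate
  depends on. FedRR samples independently over epochs and devices; FedSO samples independently
  over devices and reuses the result in all epochs. Pairs outside the product sets carry the
  irrelevant default \<open>[]\<close>.\<close>

definition fedrr_perms :: "nat \<Rightarrow> nat \<Rightarrow> nat \<Rightarrow> (nat \<times> nat \<Rightarrow> nat list) pmf" where
  "fedrr_perms M n T =
     Pi_pmf ({..<T} \<times> {1..M}) [] (\<lambda>_. pmf_of_set (permutations_of_set {1..n}))"

definition fedso_perms :: "nat \<Rightarrow> nat \<Rightarrow> (nat \<times> nat \<Rightarrow> nat list) pmf" where
  "fedso_perms M n =
     map_pmf (\<lambda>\<sigma> (t, m). \<sigma> m)
       (Pi_pmf {1..M} [] (\<lambda>_. pmf_of_set (permutations_of_set {1..n})))"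

definition sigma_star_sq ::
  "nat \<Rightarrow> nat \<Rightarrow> (nat \<Rightarrow> nat \<Rightarrow> 'a::real_inner \<Rightarrow> real) \<Rightarrow> 'a \<Rightarrow> real" where
  "sigma_star_sq M n f xs =
     1 / real (M * n) * (\<Sum>i=1..n. \<Sum>m=1..M. (norm (grad (f m i) xs))\<^sup>2)"

lemma grad_eqI:
  assumes "GDERIV f x :> D"
  shows "grad f x = D"
  unfolding grad_def
proof (rule the_equality)
  fix E assume "GDERIV f x :> E"
  then have "(\<lambda>h. h \<bullet> E) = (\<lambda>h. h \<bullet> D)"
    using assms unfolding gderiv_def by (rule has_derivative_unique)
  then have "\<forall>h. h \<bullet> E = h \<bullet> D"
    by (simp add: fun_eq_iff)
  then show "E = D"
    by (simp only: vector_eq_ldot)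
qed (rule assms)

lemma GDERIV_grad:
  fixes f :: "'a::euclidean_space \<Rightarrow> real"
  assumes "f differentiable (at x)"
  shows "GDERIV f x :> grad f x"
proof -
  obtain f' where f': "(f has_derivative f') (at x)"
    using assms unfolding differentiable_def by blast
  then interpret bounded_linear f'
    by (rule has_derivative_bounded_linear)
  have "f' h = h \<bullet> (\<Sum>b\<in>Basis. f' b *\<^sub>R b)" for h
  proof -
    have "f' h = f' (\<Sum>b\<in>Basis. (h \<bullet> b) *\<^sub>R b)"
      by (simp only: euclidean_representation)
    also have "\<dots> = (\<Sum>b\<in>Basis. (h \<bullet> b) * f' b)"
      by (simp only: sum scaleR real_scaleR_def)
    also have "\<dots> = h \<bullet> (\<Sum>b\<in>Basis. f' b *\<^sub>R b)"
      by (simp only: inner_sum_right inner_scaleR_right mult.commute)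
    finally show ?thesis .
  qed
  then have "f' = (\<lambda>h. h \<bullet> (\<Sum>b\<in>Basis. f' b *\<^sub>R b))"
    by (rule ext)
  with f' have "GDERIV f x :> (\<Sum>b\<in>Basis. f' b *\<^sub>R b)"
    unfolding gderiv_def by (rule back_subst)
  then show ?thesis
    by (simp only: grad_eqI)
qed

end

theory Submission
  imports Defs
begin

text \<open>Each local trajectory is compared with a reference trajectory that applies the same
  permutation but freezes all gradients at \<open>xs\<close>. The three-point identity for Bregman divergences
  turns one step into a contraction by \<open>1 - \<gamma> * \<mu>\<close> plus a multiple of the squared distance of the
  reference point from \<open>xs\<close>, whose expectation is a variance of sampling without replacement. As
  the gradients of a device at \<open>xs\<close> sum to zero, the reference trajectory is back at \<open>xs\<close> at the
  end of the epoch, so the epochs concatenate, and averaging over the devices is harmless by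
  convexity of the squared norm.\<close>

section \<open>Bregman divergences and a single gradient step\<close>

text \<open>Pure algebra: the function values cancel and only the gradients at \<open>x\<close> and
  \<open>z\<close> survive. It serves both the bound on gradient differences and the one-step
  contraction.\<close>

lemma bregman_three_point:
  "(grad f x - grad f z) \<bullet> (x - y) = bregman f y x + bregman f x z - bregman f y z"
  by (simp add: bregman_def inner_diff_left inner_diff_right)

lemma strongly_convex_fun_bregman_nonneg:
  assumes "strongly_convex_fun \<mu> f" "\<mu> > 0"
  shows "bregman f x y \<ge> 0"
proof -
  have "0 \<le> \<mu> / 2 * (norm (x - y))\<^sup>2"
    using assms by simp
  also have "\<dots> \<le> bregman f x y"
    using assms by (simp add: strongly_convex_fun_def)
  finally show ?thesis .
qed

text \<open>Both constants bound the same Bregman divergence, which is evaluated at a unit vector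
  and \<open>0\<close>. Together with \<gamma> * L \<le> 1 this keeps the contraction factor 1 -
  \<gamma> * \<mu> nonnegative.\<close>

lemma strong_convexity_le_smoothness:
  fixes f :: "'a::euclidean_space \<Rightarrow> real"
  assumes "smooth_fun L f" "strongly_convex_fun \<mu> f"
  shows "\<mu> \<le> L"
proof -
  obtain b :: 'a where "b \<in> Basis"
    using nonempty_Basis by blast
  then have "\<mu> / 2 * (norm (b - 0))\<^sup>2 \<le> L / 2 * (norm (b - 0))\<^sup>2"
    using assms unfolding smooth_fun_def strongly_convex_fun_def by (meson order_trans)
  with \<open>b \<in> Basis\<close> show ?thesis
    by simp
qed

text \<open>Compare \<open>f\<close> at \<open>x - (1 / L) *\<^sub>R (grad f x - grad f y)\<close> with its quadratic upper model at \<open>x\<close>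
  and its linear lower model at \<open>y\<close>.\<close>

lemma norm_grad_diff_le_bregman:
  assumes "smooth_fun L f" "L > 0" and nonneg: "\<And>u v. bregman f u v \<ge> 0"
  shows "(norm (grad f x - grad f y))\<^sup>2 \<le> 2 * L * bregman f x y"
proof -
  define d where "d = grad f x - grad f y"
  define z where "z = x - (1 / L) *\<^sub>R d"
  have "d \<bullet> (x - z) = bregman f z x + bregman f x y - bregman f z y"
    unfolding d_def by (rule bregman_three_point)
  moreover have "d \<bullet> (x - z) = (norm d)\<^sup>2 / L"
    by (simp add: z_def power2_norm_eq_inner)
  moreover have "bregman f z x \<le> L / 2 * (norm (z - x))\<^sup>2"
    using assms by (simp add: smooth_fun_def)
  moreover have "L / 2 * (norm (z - x))\<^sup>2 = (norm d)\<^sup>2 / (2 * L)"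
    using \<open>L > 0\<close> by (simp add: z_def power_divide power2_eq_square)
  ultimately have "(norm d)\<^sup>2 / L \<le> (norm d)\<^sup>2 / (2 * L) + bregman f x y"
    using nonneg[of z y] by linarith
  then show ?thesis
    using \<open>L > 0\<close> unfolding d_def[symmetric] by (simp add: field_simps)
qed

lemma gradient_step_dist_le:
  assumes smooth: "smooth_fun L f" and sc: "strongly_convex_fun \<mu> f"
    and "\<mu> > 0" "L > 0" "0 < \<gamma>" "\<gamma> * L \<le> 1"
  shows "(norm ((x - \<gamma> *\<^sub>R grad f x) - (y - \<gamma> *\<^sub>R grad f z)))\<^sup>2
    \<le> (1 - \<gamma> * \<mu>) * (norm (x - y))\<^sup>2 + \<gamma> * L * (norm (y - z))\<^sup>2"
proof -
  define d where "d = grad f x - grad f z"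
  have nonneg: "bregman f u v \<ge> 0" for u v
    using sc \<open>\<mu> > 0\<close> by (rule strongly_convex_fun_bregman_nonneg)
  have "(x - \<gamma> *\<^sub>R grad f x) - (y - \<gamma> *\<^sub>R grad f z) = (x - y) - \<gamma> *\<^sub>R d"
    by (simp add: d_def algebra_simps)
  then have "(norm ((x - \<gamma> *\<^sub>R grad f x) - (y - \<gamma> *\<^sub>R grad f z)))\<^sup>2
      = (norm ((x - y) - \<gamma> *\<^sub>R d))\<^sup>2"
    by (rule arg_cong)
  also have "\<dots> = (norm (x - y))\<^sup>2 - 2 * \<gamma> * (d \<bullet> (x - y)) + \<gamma>\<^sup>2 * (norm d)\<^sup>2"
    unfolding power2_norm_eq_inner
    by (simp add: inner_diff_left inner_diff_right inner_commute power2_eq_square algebra_simps)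
  finally have "(norm ((x - \<gamma> *\<^sub>R grad f x) - (y - \<gamma> *\<^sub>R grad f z)))\<^sup>2
      = (norm (x - y))\<^sup>2 - 2 * \<gamma> * (d \<bullet> (x - y)) + \<gamma>\<^sup>2 * (norm d)\<^sup>2" .
  moreover have "2 * \<gamma> * (d \<bullet> (x - y))
      = 2 * \<gamma> * bregman f y x + 2 * \<gamma> * bregman f x z - 2 * \<gamma> * bregman f y z"
    unfolding d_def bregman_three_point by (simp add: algebra_simps)
  moreover have "\<gamma>\<^sup>2 * (norm d)\<^sup>2 \<le> 2 * \<gamma> * bregman f x z"
  proof -
    have "\<gamma>\<^sup>2 * (norm d)\<^sup>2 \<le> \<gamma>\<^sup>2 * (2 * L * bregman f x z)"
      unfolding d_def
      using norm_grad_diff_le_bregman[OF smooth \<open>L > 0\<close> nonneg] by (intro mult_left_mono) auto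
    also have "\<dots> = (\<gamma> * L) * (2 * \<gamma> * bregman f x z)"
      by (simp add: power2_eq_square)
    also have "\<dots> \<le> 1 * (2 * \<gamma> * bregman f x z)"
      using \<open>\<gamma> * L \<le> 1\<close> \<open>0 < \<gamma>\<close> nonneg by (intro mult_right_mono) auto
    finally show ?thesis by simp
  qed
  moreover have "\<gamma> * \<mu> * (norm (x - y))\<^sup>2 \<le> 2 * \<gamma> * bregman f y x"
  proof -
    have "\<mu> / 2 * (norm (y - x))\<^sup>2 \<le> bregman f y x"
      using sc by (simp add: strongly_convex_fun_def)
    then have "2 * \<gamma> * (\<mu> / 2 * (norm (y - x))\<^sup>2) \<le> 2 * \<gamma> * bregman f y x"
      using \<open>0 < \<gamma>\<close> by (intro mult_left_mono) auto
    then show ?thesis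
      by (simp add: norm_minus_commute)
  qed
  moreover have "2 * \<gamma> * bregman f y z \<le> \<gamma> * L * (norm (y - z))\<^sup>2"
  proof -
    have "bregman f y z \<le> L / 2 * (norm (y - z))\<^sup>2"
      using smooth by (simp add: smooth_fun_def)
    then have "2 * \<gamma> * bregman f y z \<le> 2 * \<gamma> * (L / 2 * (norm (y - z))\<^sup>2)"
      using \<open>0 < \<gamma>\<close> by (intro mult_left_mono) auto
    then show ?thesis
      by simp
  qed
  ultimately show ?thesis
    by (simp add: left_diff_distrib)
qed

text \<open>Differentiability makes each \<open>grad (f j) x\<close> a true derivative, and
  derivatives add. This turns a vanishing \<open>grad (F m) xs\<close> into gradients that sum to
  zero.\<close>

lemma grad_sum:
  fixes f :: "'b \<Rightarrow> 'a::euclidean_space \<Rightarrow> real"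
  assumes "\<And>j. j \<in> J \<Longrightarrow> f j differentiable (at x)"
  shows "grad (\<lambda>x. \<Sum>j\<in>J. f j x) x = (\<Sum>j\<in>J. grad (f j) x)"
proof (rule grad_eqI)
  have "((\<lambda>x. \<Sum>j\<in>J. f j x) has_derivative (\<lambda>h. \<Sum>j\<in>J. h \<bullet> grad (f j) x)) (at x)"
    using GDERIV_grad[OF assms] unfolding gderiv_def by (intro has_derivative_sum)
  then show "GDERIV (\<lambda>x. \<Sum>j\<in>J. f j x) x :> (\<Sum>j\<in>J. grad (f j) x)"
    by (simp add: gderiv_def inner_sum_right)
qed

section \<open>Random permutations and their partial sums\<close>

lemma sum_nth_permutation:
  assumes "p \<in> permutations_of_set A"
  shows "(\<Sum>k<card A. h (p ! k)) = sum h A"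
proof -
  have "distinct p" "set p = A"
    using assms by (auto dest: permutations_of_setD)
  then have "bij_betw ((!) p) {..<card A} A"
    by (intro bij_betw_nth) (auto simp: distinct_card)
  then show ?thesis
    by (rule sum.reindex_bij_betw)
qed

text \<open>Swapping two positions is an involution on the permutations of \<open>A\<close>, hence
  preserves their uniform law. This is the exchangeability used for sampling without
  replacement.\<close>

lemma expectation_permutation_swap:
  fixes H :: "'b list \<Rightarrow> real"
  assumes "finite A" "i < card A" "j < card A"
  defines "U \<equiv> pmf_of_set (permutations_of_set A)"
  shows "measure_pmf.expectation U (\<lambda>p. H (permute_list (Transposition.transpose i j) p))
    = measure_pmf.expectation U H"
proof -
  let ?s = "permute_list (Transposition.transpose i j)"
  note len = length_finite_permutations_of_set
  have perm: "Transposition.transpose i j permutes {..<card A}"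
    using assms by (intro permutes_swap_id) auto
  have closed: "?s p \<in> permutations_of_set A" if "p \<in> permutations_of_set A" for p
    using that perm len[OF that]
    by (auto simp: permutations_of_set_def)
  have inv: "?s (?s p) = p" if "p \<in> permutations_of_set A" for p
    using perm len[OF that] by (simp flip: permute_list_compose)
  have "bij_betw ?s (permutations_of_set A) (permutations_of_set A)"
    by (rule bij_betw_byWitness[where f' = ?s]) (use closed inv in auto)
  then have "map_pmf ?s U = U"
    unfolding U_def using assms by (intro map_pmf_of_set_bij_betw) auto
  then show ?thesis
    by (metis integral_map_pmf)
qed

text \<open>With \<open>S\<close> the sum of the first \<open>i\<close> terms, exchangeability makes the expectation of \<open>S \<bullet> h (p ! l)\<close>
  the same for all \<open>l \<ge> i\<close>; these terms sum to \<open>- (norm S)\<^sup>2\<close>, so the cross terms are nonpositive.\<close>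

lemma expectation_norm_permutation_prefix_le:
  fixes h :: "'b \<Rightarrow> 'a::real_inner"
  assumes fin: "finite A" and zero: "sum h A = 0" and "i \<le> card A"
  defines "U \<equiv> pmf_of_set (permutations_of_set A)"
  shows "measure_pmf.expectation U (\<lambda>p. (norm (\<Sum>k<i. h (p ! k)))\<^sup>2)
    \<le> real i / real (card A) * (\<Sum>a\<in>A. (norm (h a))\<^sup>2)"
  using \<open>i \<le> card A\<close>
proof (induction i)
  case 0
  then show ?case by simp
next
  case (Suc i)
  let ?E = "measure_pmf.expectation U"
  let ?n = "card A"
  define S where "S p = (\<Sum>k<i. h (p ! k))" for p
  have i: "i < ?n" using Suc.prems by simp
  have set_U: "set_pmf U = permutations_of_set A"
    unfolding U_def using fin by (intro set_pmf_of_set) auto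
  \<comment> \<open>The support of \<open>U\<close> is finite, so linearity of the expectation
    applies without side conditions.\<close>
  have [simp, intro]: "integrable (measure_pmf U) H" for H :: "'b list \<Rightarrow> real"
    using fin by (intro integrable_measure_pmf_finite) (simp add: set_U)
  have E_cong: "?E H = ?E H'" if "\<And>p. p \<in> permutations_of_set A \<Longrightarrow> H p = H' p" for H H'
    by (rule integral_cong_AE) (use that in \<open>auto simp: AE_measure_pmf_iff set_U\<close>)
  note len = length_finite_permutations_of_set
  have nth: "permute_list (Transposition.transpose i l) p ! k = p ! Transposition.transpose i l k"
    if "p \<in> permutations_of_set A" "l < ?n" "k < ?n" for p l k
    using that i by (intro permute_list_nth) (auto simp: len intro!: permutes_swap_id)
  have norm_eq: "?E (\<lambda>p. (norm (h (p ! i)))\<^sup>2) = ?E (\<lambda>p. (norm (h (p ! l)))\<^sup>2)" if "l < ?n" for l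
  proof -
    have "?E (\<lambda>p. (norm (h (p ! i)))\<^sup>2)
        = ?E (\<lambda>p. (norm (h (permute_list (Transposition.transpose i l) p ! i)))\<^sup>2)"
      unfolding U_def by (rule expectation_permutation_swap[OF fin i that, symmetric])
    also have "\<dots> = ?E (\<lambda>p. (norm (h (p ! l)))\<^sup>2)"
      by (rule E_cong) (simp add: nth that i)
    finally show ?thesis .
  qed
  \<comment> \<open>By \<open>norm_eq\<close> all positions contribute equally, and their total does
    not depend on \<open>p\<close>.\<close>
  have "real ?n * ?E (\<lambda>p. (norm (h (p ! i)))\<^sup>2) = (\<Sum>l<?n. ?E (\<lambda>p. (norm (h (p ! l)))\<^sup>2))"
    by (simp flip: norm_eq)
  also have "\<dots> = ?E (\<lambda>p. \<Sum>l<?n. (norm (h (p ! l)))\<^sup>2)"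
    by simp
  also have "\<dots> = ?E (\<lambda>p. \<Sum>a\<in>A. (norm (h a))\<^sup>2)"
    by (rule E_cong) (rule sum_nth_permutation)
  finally have E_norm: "?E (\<lambda>p. (norm (h (p ! i)))\<^sup>2) = (\<Sum>a\<in>A. (norm (h a))\<^sup>2) / real ?n"
    using i by (simp add: field_simps)
  have inner_eq: "?E (\<lambda>p. S p \<bullet> h (p ! i)) = ?E (\<lambda>p. S p \<bullet> h (p ! l))"
    if "l \<in> {i..<?n}" for l
  proof -
    have l: "l < ?n" "i \<le> l" using that by auto
    have "?E (\<lambda>p. S p \<bullet> h (p ! i))
        = ?E (\<lambda>p. S (permute_list (Transposition.transpose i l) p) \<bullet> h (permute_list (Transposition.transpose i l) p ! i))"
      unfolding U_def by (rule expectation_permutation_swap[OF fin i \<open>l < ?n\<close>, symmetric])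
    also have "\<dots> = ?E (\<lambda>p. S p \<bullet> h (p ! l))"
    proof (rule E_cong)
      fix p assume p: "p \<in> permutations_of_set A"
      \<comment> \<open>The swap moves only \<open>i\<close> and \<open>l\<close>, both outside the
        prefix of positions below \<open>i\<close>.\<close>
      have "S (permute_list (Transposition.transpose i l) p) = S p"
        unfolding S_def using l i
        by (intro sum.cong refl) (auto simp: nth[OF p] transpose_apply_other)
      then show "S (permute_list (Transposition.transpose i l) p) \<bullet> h (permute_list (Transposition.transpose i l) p ! i)
          = S p \<bullet> h (p ! l)"
        using l i by (simp add: nth[OF p])
    qed
    finally show ?thesis .
  qed
  have "real (?n - i) * ?E (\<lambda>p. S p \<bullet> h (p ! i)) = (\<Sum>l\<in>{i..<?n}. ?E (\<lambda>p. S p \<bullet> h (p ! l)))"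
    by (subst sum.cong[OF refl inner_eq[symmetric]]) simp_all
  also have "\<dots> = ?E (\<lambda>p. \<Sum>l\<in>{i..<?n}. S p \<bullet> h (p ! l))"
    by simp
  also have "\<dots> = ?E (\<lambda>p. - (norm (S p))\<^sup>2)"
  proof (rule E_cong)
    fix p assume p: "p \<in> permutations_of_set A"
    have "S p + (\<Sum>l\<in>{i..<?n}. h (p ! l)) = (\<Sum>l<?n. h (p ! l))"
      unfolding S_def using i by (simp add: lessThan_atLeast0 sum.atLeastLessThan_concat)
    also have "\<dots> = 0"
      using sum_nth_permutation[OF p, of h] zero by simp
    finally have "(\<Sum>l\<in>{i..<?n}. h (p ! l)) = - S p"
      by (simp add: eq_neg_iff_add_eq_0 add.commute)
    then show "(\<Sum>l\<in>{i..<?n}. S p \<bullet> h (p ! l)) = - (norm (S p))\<^sup>2"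
      by (simp add: inner_sum_right[symmetric] power2_norm_eq_inner)
  qed
  also have "\<dots> \<le> 0"
    by simp
  \<comment> \<open>The factor \<open>?n - i\<close> is positive because \<open>i < ?n\<close>, so
    it can be divided out.\<close>
  finally have E_inner: "?E (\<lambda>p. S p \<bullet> h (p ! i)) \<le> 0"
    using i by (simp add: mult_le_0_iff)
  have "?E (\<lambda>p. (norm (\<Sum>k<Suc i. h (p ! k)))\<^sup>2)
      = ?E (\<lambda>p. (norm (S p))\<^sup>2 + 2 * (S p \<bullet> h (p ! i)) + (norm (h (p ! i)))\<^sup>2)"
    by (simp add: S_def power2_norm_eq_inner inner_add_left inner_add_right inner_commute
        algebra_simps)
  also have "\<dots> = ?E (\<lambda>p. (norm (S p))\<^sup>2) + 2 * ?E (\<lambda>p. S p \<bullet> h (p ! i))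
      + ?E (\<lambda>p. (norm (h (p ! i)))\<^sup>2)"
    by simp
  also have "\<dots> \<le> real i / real ?n * (\<Sum>a\<in>A. (norm (h a))\<^sup>2)
      + (\<Sum>a\<in>A. (norm (h a))\<^sup>2) / real ?n"
    using Suc E_inner E_norm by (simp add: S_def)
  also have "\<dots> = real (Suc i) / real ?n * (\<Sum>a\<in>A. (norm (h a))\<^sup>2)"
    by (simp add: add_divide_distrib distrib_right)
  finally show ?case .
qed

section \<open>Averages, linear recursions and the bound for a general law of permutations\<close>

text \<open>Triangle inequality followed by Cauchy-Schwarz. For empty \<open>I\<close> both sides
  are \<open>0\<close>, since \<open>1 / 0 = 0\<close>.\<close>

lemma norm_average_squared_le:
  fixes v :: "'b \<Rightarrow> 'a::real_normed_vector"
  assumes "finite I"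
  shows "(norm ((1 / real (card I)) *\<^sub>R sum v I))\<^sup>2 \<le> 1 / real (card I) * (\<Sum>i\<in>I. (norm (v i))\<^sup>2)"
proof -
  have "(norm (sum v I))\<^sup>2 \<le> (\<Sum>i\<in>I. norm (v i))\<^sup>2"
    by (intro power_mono norm_sum) simp
  also have "\<dots> \<le> (\<Sum>i\<in>I. (norm (v i))\<^sup>2) * real (card I)"
    by (rule sum_squared_le_sum_of_squares)
  finally show ?thesis
    by (cases "card I = 0") (auto simp: power_divide power2_eq_square field_simps)
qed

text \<open>Writing the noise as \<open>(1 - q) * K\<close> makes \<open>K\<close> the fixed point,
  so no geometric series has to be summed. At \<open>i = n\<close> the bound has the shape of the
  hypothesis with \<open>q ^ n\<close> for \<open>q\<close>, so the lemma applies first to local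
  steps and then to epochs.\<close>

lemma contraction_recursion:
  fixes a :: "nat \<Rightarrow> real"
  assumes "q \<ge> 0" and "\<And>i. i < n \<Longrightarrow> a (Suc i) \<le> q * a i + (1 - q) * K"
  shows "i \<le> n \<Longrightarrow> a i \<le> q ^ i * a 0 + (1 - q ^ i) * K"
proof (induction i)
  case (Suc i)
  have "a (Suc i) \<le> q * a i + (1 - q) * K"
    using Suc.prems by (intro assms) simp
  also have "\<dots> \<le> q * (q ^ i * a 0 + (1 - q ^ i) * K) + (1 - q) * K"
    using Suc assms(1) by (intro add_right_mono mult_left_mono) auto
  finally show ?case
    by (simp add: algebra_simps)
qed simp

text \<open>Only the one-dimensional marginals of the law of the permutations matter, which is why
  FedRR and FedSO satisfy the same bound.\<close>

lemma expectation_fed_iter_le: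
  fixes f :: "nat \<Rightarrow> nat \<Rightarrow> 'a::euclidean_space \<Rightarrow> real"
  assumes M: "M \<ge> 1"
    and smooth: "\<And>m j. m \<in> {1..M} \<Longrightarrow> j \<in> {1..n} \<Longrightarrow> smooth_fun L (f m j)"
    and sc: "\<And>m j. m \<in> {1..M} \<Longrightarrow> j \<in> {1..n} \<Longrightarrow> strongly_convex_fun \<mu> (f m j)"
    and "\<mu> > 0" "0 < \<gamma>" "L > 0" "\<gamma> * L \<le> 1" "\<mu> \<le> L"
    and zero: "\<And>m. m \<in> {1..M} \<Longrightarrow> (\<Sum>j=1..n. grad (f m j) xs) = 0"
    and fin: "finite (set_pmf P)"
    and marginal: "\<And>t m. t < T \<Longrightarrow> m \<in> {1..M} \<Longrightarrow>
      map_pmf (\<lambda>\<pi>. \<pi> (t, m)) P = pmf_of_set (permutations_of_set {1..n})"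
  shows "measure_pmf.expectation P (\<lambda>\<pi>. (norm (fed_iter M n \<gamma> f x0 \<pi> T - xs))\<^sup>2)
    \<le> (1 - \<gamma> * \<mu>) ^ (n * T) * (norm (x0 - xs))\<^sup>2
       + \<gamma>\<^sup>2 * L / (real M * \<mu>) * (\<Sum>m=1..M. \<Sum>j=1..n. (norm (grad (f m j) xs))\<^sup>2)"
proof -
  let ?E = "measure_pmf.expectation P"
  define q where "q = 1 - \<gamma> * \<mu>"
  define V where "V m = (\<Sum>j=1..n. (norm (grad (f m j) xs))\<^sup>2)" for m
  \<comment> \<open>Since \<open>1 - q\<close> equals \<gamma> * \<mu>, this choice gives the noise
    of one local step the form \<open>(1 - q) * (K * V m)\<close>.\<close>
  define K where "K = \<gamma>\<^sup>2 * L / \<mu>"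
  have "\<gamma> * \<mu> \<le> \<gamma> * L"
    using assms by (intro mult_left_mono) auto
  then have "\<gamma> * \<mu> \<le> 1"
    using \<open>\<gamma> * L \<le> 1\<close> by (rule order_trans)
  then have q: "0 \<le> q" "q \<le> 1"
    using \<open>\<gamma> * L \<le> 1\<close> \<open>\<mu> > 0\<close> \<open>0 < \<gamma>\<close> by (auto simp: q_def)
  have K: "(1 - q) * (K * v) = \<gamma> * L * (\<gamma>\<^sup>2 * v)" for v
    using \<open>\<mu> > 0\<close> by (simp add: q_def K_def)
  have [simp, intro]: "integrable (measure_pmf P) H" for H :: "_ \<Rightarrow> real"
    using fin by (rule integrable_measure_pmf_finite)
  have E_mono: "?E H \<le> ?E H'" if "\<And>\<pi>. \<pi> \<in> set_pmf P \<Longrightarrow> H \<pi> \<le> H' \<pi>" for H H' :: "_ \<Rightarrow> real"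
    by (rule integral_mono_AE) (use that in \<open>auto simp: AE_measure_pmf_iff\<close>)
  define X where "X \<pi> t = fed_iter M n \<gamma> f x0 \<pi> t" for \<pi> t
  have local: "?E (\<lambda>\<pi>. (norm (local_iter \<gamma> (f m) (\<pi> (t, m)) (X \<pi> t) n - xs))\<^sup>2)
      \<le> q ^ n * ?E (\<lambda>\<pi>. (norm (X \<pi> t - xs))\<^sup>2) + (1 - q ^ n) * (K * V m)"
    if t: "t < T" and m: "m \<in> {1..M}" for t m
  proof -
    define S where "S p i = (\<Sum>k<i. grad (f m (p ! k)) xs)" for p i
    define x where "x \<pi> i = local_iter \<gamma> (f m) (\<pi> (t, m)) (X \<pi> t) i" for \<pi> i
    \<comment> \<open>The reference trajectory in closed form; \<open>S\<close> is empty at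
      \<open>i = 0\<close>, so it starts at \<open>xs\<close>.\<close>
    define y where "y \<pi> i = xs - \<gamma> *\<^sub>R S (\<pi> (t, m)) i" for \<pi> i
    have perm: "\<pi> (t, m) \<in> permutations_of_set {1..n}" if "\<pi> \<in> set_pmf P" for \<pi>
    proof -
      have "\<pi> (t, m) \<in> set_pmf (map_pmf (\<lambda>\<pi>. \<pi> (t, m)) P)"
        using that by auto
      then show ?thesis
        by (simp add: marginal[OF t m])
    qed
    have "?E (\<lambda>\<pi>. (norm (x \<pi> (Suc i) - y \<pi> (Suc i)))\<^sup>2)
        \<le> q * ?E (\<lambda>\<pi>. (norm (x \<pi> i - y \<pi> i))\<^sup>2) + (1 - q) * (K * V m)" if "i < n" for i
    proof -
      \<comment> \<open>The one-step bound holds for each fixed outcome, so \<open>X \<pi> t\<close>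
        and \<open>\<pi> (t, m)\<close> may be dependent, as happens in FedSO.\<close>
      have "?E (\<lambda>\<pi>. (norm (x \<pi> (Suc i) - y \<pi> (Suc i)))\<^sup>2)
          \<le> ?E (\<lambda>\<pi>. q * (norm (x \<pi> i - y \<pi> i))\<^sup>2 + \<gamma> * L * (\<gamma>\<^sup>2 * (norm (S (\<pi> (t, m)) i))\<^sup>2))"
      proof (rule E_mono)
        fix \<pi> assume \<pi>: "\<pi> \<in> set_pmf P"
        define j where "j = \<pi> (t, m) ! i"
        have "j \<in> set (\<pi> (t, m))"
          unfolding j_def using length_finite_permutations_of_set[OF perm[OF \<pi>]] \<open>i < n\<close>
          by (intro nth_mem) simp
        then have j: "j \<in> {1..n}"
          using perm[OF \<pi>] by (auto dest: permutations_of_setD)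
        have "x \<pi> (Suc i) = x \<pi> i - \<gamma> *\<^sub>R grad (f m j) (x \<pi> i)"
          by (simp add: x_def j_def)
        moreover have "y \<pi> (Suc i) = y \<pi> i - \<gamma> *\<^sub>R grad (f m j) xs"
          by (simp add: y_def S_def j_def algebra_simps)
        moreover have "(norm (y \<pi> i - xs))\<^sup>2 = \<gamma>\<^sup>2 * (norm (S (\<pi> (t, m)) i))\<^sup>2"
          by (simp add: y_def power_mult_distrib)
        ultimately show "(norm (x \<pi> (Suc i) - y \<pi> (Suc i)))\<^sup>2
            \<le> q * (norm (x \<pi> i - y \<pi> i))\<^sup>2 + \<gamma> * L * (\<gamma>\<^sup>2 * (norm (S (\<pi> (t, m)) i))\<^sup>2)"
          using gradient_step_dist_le[OF smooth[OF m j] sc[OF m j] \<open>\<mu> > 0\<close> \<open>L > 0\<close> \<open>0 < \<gamma>\<close> \<open>\<gamma> * L \<le> 1\<close>,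
              of "x \<pi> i" "y \<pi> i" xs]
          by (simp add: q_def)
      qed
      also have "\<dots> = q * ?E (\<lambda>\<pi>. (norm (x \<pi> i - y \<pi> i))\<^sup>2)
          + \<gamma> * L * (\<gamma>\<^sup>2 * ?E (\<lambda>\<pi>. (norm (S (\<pi> (t, m)) i))\<^sup>2))"
        by simp
      \<comment> \<open>Only the marginal of \<open>\<pi> (t, m)\<close> enters here. The factor
        \<open>i / n\<close> from the prefix bound is relaxed to \<open>1\<close>, which makes the
        noise the same in every step.\<close>
      also have "?E (\<lambda>\<pi>. (norm (S (\<pi> (t, m)) i))\<^sup>2) \<le> V m"
      proof -
        have "?E (\<lambda>\<pi>. (norm (S (\<pi> (t, m)) i))\<^sup>2)
            = measure_pmf.expectation (map_pmf (\<lambda>\<pi>. \<pi> (t, m)) P) (\<lambda>p. (norm (S p i))\<^sup>2)"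
          by simp
        also have "\<dots> \<le> real i / real n * V m"
          unfolding marginal[OF t m] S_def V_def
          using expectation_norm_permutation_prefix_le[of "{1..n}" "\<lambda>j. grad (f m j) xs" i]
            zero[OF m] \<open>i < n\<close> by simp
        also have "\<dots> \<le> 1 * V m"
          using \<open>i < n\<close> by (intro mult_right_mono) (auto simp: V_def sum_nonneg)
        finally show ?thesis by simp
      qed
      finally show ?thesis
        using \<open>0 < \<gamma>\<close> \<open>L > 0\<close> unfolding K by simp
    qed
    from contraction_recursion[where a = "\<lambda>i. ?E (\<lambda>\<pi>. (norm (x \<pi> i - y \<pi> i))\<^sup>2)",
        OF q(1) this order.refl]
    have "?E (\<lambda>\<pi>. (norm (x \<pi> n - y \<pi> n))\<^sup>2)
        \<le> q ^ n * ?E (\<lambda>\<pi>. (norm (x \<pi> 0 - y \<pi> 0))\<^sup>2) + (1 - q ^ n) * (K * V m)" .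
    \<comment> \<open>A full pass uses every gradient at \<open>xs\<close> exactly once, so
      \<open>y \<pi> n = xs\<close>.\<close>
    moreover have "?E (\<lambda>\<pi>. (norm (x \<pi> n - xs))\<^sup>2) \<le> ?E (\<lambda>\<pi>. (norm (x \<pi> n - y \<pi> n))\<^sup>2)"
    proof (rule E_mono)
      fix \<pi> assume "\<pi> \<in> set_pmf P"
      then have "S (\<pi> (t, m)) n = 0"
        using sum_nth_permutation[OF perm, of \<pi> "\<lambda>j. grad (f m j) xs"] zero[OF m]
        by (simp add: S_def)
      then show "(norm (x \<pi> n - xs))\<^sup>2 \<le> (norm (x \<pi> n - y \<pi> n))\<^sup>2"
        by (simp add: y_def)
    qed
    ultimately show ?thesis
      by (simp add: x_def y_def S_def)
  qed
  define V' where "V' = 1 / real M * (\<Sum>m=1..M. V m)"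
  have "?E (\<lambda>\<pi>. (norm (X \<pi> (Suc t) - xs))\<^sup>2)
      \<le> q ^ n * ?E (\<lambda>\<pi>. (norm (X \<pi> t - xs))\<^sup>2) + (1 - q ^ n) * (K * V')" if t: "t < T" for t
  proof -
    let ?x = "\<lambda>\<pi> m. local_iter \<gamma> (f m) (\<pi> (t, m)) (X \<pi> t) n"
    have "?E (\<lambda>\<pi>. (norm (X \<pi> (Suc t) - xs))\<^sup>2)
        \<le> ?E (\<lambda>\<pi>. 1 / real M * (\<Sum>m=1..M. (norm (?x \<pi> m - xs))\<^sup>2))"
    proof (rule E_mono)
      fix \<pi>
      have "X \<pi> (Suc t) - xs = (1 / real M) *\<^sub>R (\<Sum>m=1..M. ?x \<pi> m - xs)"
        using M by (simp add: X_def sum_subtractf scaleR_diff_right sum_constant_scaleR)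
      then show "(norm (X \<pi> (Suc t) - xs))\<^sup>2 \<le> 1 / real M * (\<Sum>m=1..M. (norm (?x \<pi> m - xs))\<^sup>2)"
        using norm_average_squared_le[of "{1..M}" "\<lambda>m. ?x \<pi> m - xs"] by simp
    qed
    also have "\<dots> = 1 / real M * (\<Sum>m=1..M. ?E (\<lambda>\<pi>. (norm (?x \<pi> m - xs))\<^sup>2))"
      by simp
    also have "\<dots> \<le> 1 / real M * (\<Sum>m=1..M. q ^ n * ?E (\<lambda>\<pi>. (norm (X \<pi> t - xs))\<^sup>2)
        + (1 - q ^ n) * (K * V m))"
      using t by (intro mult_left_mono sum_mono local) auto
    also have "\<dots> = q ^ n * ?E (\<lambda>\<pi>. (norm (X \<pi> t - xs))\<^sup>2) + (1 - q ^ n) * (K * V')"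
      using M by (simp add: V'_def sum.distrib distrib_left flip: sum_distrib_left)
    finally show ?thesis .
  qed
  \<comment> \<open>The recursion now runs over epochs, with factor \<open>q ^ n\<close> and the
    device average \<open>V'\<close> in the noise.\<close>
  from contraction_recursion[where a = "\<lambda>t. ?E (\<lambda>\<pi>. (norm (X \<pi> t - xs))\<^sup>2)",
      OF zero_le_power[OF q(1)] this order.refl]
  have "?E (\<lambda>\<pi>. (norm (X \<pi> T - xs))\<^sup>2)
      \<le> (q ^ n) ^ T * (norm (x0 - xs))\<^sup>2 + (1 - (q ^ n) ^ T) * (K * V')"
    using q by (simp add: X_def)
  \<comment> \<open>The factor \<open>1 - (q ^ n) ^ T\<close> is at most \<open>1\<close> and
    \<open>K * V'\<close> is nonnegative.\<close>
  also have "\<dots> \<le> q ^ (n * T) * (norm (x0 - xs))\<^sup>2 + 1 * (K * V')"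
    using q \<open>\<mu> > 0\<close> \<open>L > 0\<close>
    by (intro add_mono mult_right_mono)
      (auto simp: power_mult K_def V'_def V_def intro!: mult_nonneg_nonneg divide_nonneg_nonneg sum_nonneg)
  finally show ?thesis
    by (simp add: X_def q_def K_def V'_def V_def field_simps)
qed

section \<open>The two sampling schemes\<close>

lemma finite_set_pmf_Pi_permutations:
  assumes "finite A" "finite B"
  shows "finite (set_pmf (Pi_pmf A [] (\<lambda>_. pmf_of_set (permutations_of_set B))))"
  using assms by (simp add: set_Pi_pmf finite_PiE_dflt)

theorem theorem8:
  fixes M n N T :: nat
    and f :: "nat \<Rightarrow> nat \<Rightarrow> real ^ 'd \<Rightarrow> real"
    and F :: "nat \<Rightarrow> real ^ 'd \<Rightarrow> real"
    and Lmax \<mu> \<gamma> :: real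
    and x0 xs :: "real ^ 'd"
  assumes "M \<ge> 1" and "n \<ge> 1" and N: "N = M * n"
    and "\<And>m j. m \<in> {1..M} \<Longrightarrow> j \<in> {1..n} \<Longrightarrow> smooth_fun Lmax (f m j)"
    and "\<mu> > 0"
    and "\<And>m j. m \<in> {1..M} \<Longrightarrow> j \<in> {1..n} \<Longrightarrow> strongly_convex_fun \<mu> (f m j)"
    and F: "\<And>m x. m \<in> {1..M} \<Longrightarrow> F m x = (\<Sum>j=1..n. f m j x)"
    and "is_arg_min (\<lambda>x. 1 / real N * (\<Sum>m=1..M. F m x)) (\<lambda>_. True) xs"
    and "\<And>m. m \<in> {1..M} \<Longrightarrow> grad (F m) xs = 0"
    and "0 < \<gamma>" and "\<gamma> \<le> 1 / Lmax"
  shows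
    "measure_pmf.expectation (fedrr_perms M n T)
         (\<lambda>\<pi>. (norm (fed_iter M n \<gamma> f x0 \<pi> T - xs))\<^sup>2)
       \<le> (1 - \<gamma> * \<mu>) ^ (n * T) * (norm (x0 - xs))\<^sup>2
          + \<gamma>\<^sup>2 * Lmax * real N * sigma_star_sq M n f xs / (real M * \<mu>) \<and>
     measure_pmf.expectation (fedso_perms M n)
         (\<lambda>\<pi>. (norm (fed_iter M n \<gamma> f x0 \<pi> T - xs))\<^sup>2)
       \<le> (1 - \<gamma> * \<mu>) ^ (n * T) * (norm (x0 - xs))\<^sup>2
          + \<gamma>\<^sup>2 * Lmax * real N * sigma_star_sq M n f xs / (real M * \<mu>)"
proof -
  \<comment> \<open>The step size bounds force \<open>1 / Lmax\<close> to be positive; this also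
    excludes \<open>Lmax = 0\<close>, where \<open>1 / Lmax\<close> is \<open>0\<close>.\<close>
  have "Lmax > 0"
    using \<open>0 < \<gamma>\<close> \<open>\<gamma> \<le> 1 / Lmax\<close> by (metis less_le_trans zero_less_divide_1_iff)
  then have "\<gamma> * Lmax \<le> 1"
    using \<open>\<gamma> \<le> 1 / Lmax\<close> by (simp add: field_simps)
  \<comment> \<open>The function with indices \<open>m = j = 1\<close> exists because
    \<open>M\<close> and \<open>n\<close> are at least \<open>1\<close>.\<close>
  have "\<mu> \<le> Lmax"
    using assms(1,2) by (intro strong_convexity_le_smoothness[OF assms(4,6)[of 1 1]]) auto
  have zero: "(\<Sum>j=1..n. grad (f m j) xs) = 0" if m: "m \<in> {1..M}" for m
  proof -
    have "F m = (\<lambda>x. \<Sum>j=1..n. f m j x)"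
      using F[OF m] by (rule ext)
    then have "grad (F m) xs = (\<Sum>j=1..n. grad (f m j) xs)"
      using assms(4)[OF m] by (simp only: smooth_fun_def) (rule grad_sum, blast)
    then show ?thesis
      using assms(9)[OF m] by simp
  qed
  \<comment> \<open>Multiplying by \<open>N\<close>, which is nonzero, undoes the averaging in
    \<open>sigma_star_sq\<close>; the order of summation is then swapped.\<close>
  have "(\<Sum>m=1..M. \<Sum>j=1..n. (norm (grad (f m j) xs))\<^sup>2) = real N * sigma_star_sq M n f xs"
    using assms(1,2) by (simp add: sigma_star_sq_def N) (rule sum.swap)
  then have noise: "\<gamma>\<^sup>2 * Lmax / (real M * \<mu>) * (\<Sum>m=1..M. \<Sum>j=1..n. (norm (grad (f m j) xs))\<^sup>2)
      = \<gamma>\<^sup>2 * Lmax * real N * sigma_star_sq M n f xs / (real M * \<mu>)"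
    by simp
  have bound: "measure_pmf.expectation P (\<lambda>\<pi>. (norm (fed_iter M n \<gamma> f x0 \<pi> T - xs))\<^sup>2)
       \<le> (1 - \<gamma> * \<mu>) ^ (n * T) * (norm (x0 - xs))\<^sup>2
          + \<gamma>\<^sup>2 * Lmax * real N * sigma_star_sq M n f xs / (real M * \<mu>)"
    if "finite (set_pmf P)" and "\<And>t m. t < T \<Longrightarrow> m \<in> {1..M} \<Longrightarrow>
      map_pmf (\<lambda>\<pi>. \<pi> (t, m)) P = pmf_of_set (permutations_of_set {1..n})" for P
    unfolding noise[symmetric]
    using assms(1) assms(4) assms(6) assms(5) assms(10) \<open>Lmax > 0\<close> \<open>\<gamma> * Lmax \<le> 1\<close> \<open>\<mu> \<le> Lmax\<close>
      zero that
    by (rule expectation_fed_iter_le)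
  show ?thesis
  proof
    show "measure_pmf.expectation (fedrr_perms M n T)
         (\<lambda>\<pi>. (norm (fed_iter M n \<gamma> f x0 \<pi> T - xs))\<^sup>2)
       \<le> (1 - \<gamma> * \<mu>) ^ (n * T) * (norm (x0 - xs))\<^sup>2
          + \<gamma>\<^sup>2 * Lmax * real N * sigma_star_sq M n f xs / (real M * \<mu>)"
    proof (rule bound)
      show "finite (set_pmf (fedrr_perms M n T))"
        unfolding fedrr_perms_def by (simp add: finite_set_pmf_Pi_permutations)
    next
      fix t m assume "t < T" "m \<in> {1..M}"
      \<comment> \<open>As \<open>t < T\<close>, the pair lies in the index set of the product, so
        its coordinate is uniform rather than the default \<open>[]\<close>.\<close>
      then show "map_pmf (\<lambda>\<pi>. \<pi> (t, m)) (fedrr_perms M n T)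
          = pmf_of_set (permutations_of_set {1..n})"
        unfolding fedrr_perms_def by (subst Pi_pmf_component) auto
    qed
    show "measure_pmf.expectation (fedso_perms M n)
         (\<lambda>\<pi>. (norm (fed_iter M n \<gamma> f x0 \<pi> T - xs))\<^sup>2)
       \<le> (1 - \<gamma> * \<mu>) ^ (n * T) * (norm (x0 - xs))\<^sup>2
          + \<gamma>\<^sup>2 * Lmax * real N * sigma_star_sq M n f xs / (real M * \<mu>)"
    proof (rule bound)
      show "finite (set_pmf (fedso_perms M n))"
        unfolding fedso_perms_def by (simp add: finite_set_pmf_Pi_permutations)
    next
      fix t m assume "m \<in> {1..M}"
      \<comment> \<open>Coordinate \<open>(t, m)\<close> reads off \<open>\<sigma> m\<close> for
        every \<open>t\<close>, so reuse across epochs leaves each marginal uniform.\<close>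
      then show "map_pmf (\<lambda>\<pi>. \<pi> (t, m)) (fedso_perms M n)
          = pmf_of_set (permutations_of_set {1..n})"
        unfolding fedso_perms_def pmf.map_comp o_def case_prod_conv
        by (subst Pi_pmf_component) auto
    qed
  qed
qed

end
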